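(* Let $(G,* )$ be a groupoid and let $A:G\to\mathbb{R}$ be a function. Assume that there exist functions $f,g:G\to\mathbb{R}$ such that $$A(x*y)=f(x)g(y)+g(x)f(y)$$ holds for all $x,y\in G$. Then $$A(x*x)\,A(y*y)\leq A(x*y)^2$$ for all $x,y\in G$.
   Context: A groupoid $(G,* )$ is a set $G$ together with a binary operation $*:G\times G\to G$ (a magma); no associativity, commutativity or other property is assumed. $A(u)^2$ denotes $(A(u))^2$. *)

theory Defs
  imports Complex_Main "HOL-Library.FuncSet"
begin

text \<open>A groupoid in the sense of a magma: no law beyond closure is required.\<close>

definition groupoid :: "'a set \<Rightarrow> ('a \<Rightarrow> 'a \<Rightarrow> 'a) \<Rightarrow> bool"
  where "groupoid G m \<longleftrightarrow> m \<in> G \<rightarrow> G \<rightarrow> G"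

end

theory Submission
  imports Defs
begin

theorem theorem3p2:
  fixes G :: "'a set"
    and m :: "'a \<Rightarrow> 'a \<Rightarrow> 'a"
    and A :: "'a \<Rightarrow> real"
  assumes "groupoid G m"
    and "\<exists>f g :: 'a \<Rightarrow> real. \<forall>x\<in>G. \<forall>y\<in>G. A (m x y) = f x * g y + g x * f y"
  shows "\<forall>x\<in>G. \<forall>y\<in>G. A (m x x) * A (m y y) \<le> (A (m x y))\<^sup>2"
proof (intro ballI)
  fix x y assume "x \<in> G" "y \<in> G"
  obtain f g :: "'a \<Rightarrow> real"
    where A: "\<And>x y. x \<in> G \<Longrightarrow> y \<in> G \<Longrightarrow> A (m x y) = f x * g y + g x * f y"
    using assms(2) by blast
  \<comment> \<open>With \<open>p = f x * g y\<close> and \<open>q = g x * f y\<close>, the two sides of the claim are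
    \<open>4 * p * q\<close> and \<open>(p + q)\<^sup>2\<close>, which differ by a square.\<close>
  have "(A (m x y))\<^sup>2 - A (m x x) * A (m y y) = (f x * g y - g x * f y)\<^sup>2"
    using \<open>x \<in> G\<close> \<open>y \<in> G\<close> by (simp add: A power2_eq_square algebra_simps)
  also have "\<dots> \<ge> 0" by simp
  finally show "A (m x x) * A (m y y) \<le> (A (m x y))\<^sup>2" by simp
qed

end
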